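(* For every integer $s\ge 5$, one has $$\Pi_{T_s+5}=\{(2,1),(1,2)\},$$ and $$|M^{(2,1)}_{T_s+5}|=|M^{(1,2)}_{T_s+5}|=4.$$ Hence $|M_{T_s+5}|=8$ and $m^{\mathrm{sc}}_{T_s+5}=0$.
   Context: For an integer $m\ge 0$, $T_m:=m(m+1)/2$. Compressed form: a partition $\lambda$ is written $\lambda=(L_1^{m_1},\dots,L_r^{m_r})$ with $L_1>\cdots>L_r>0$ its distinct part sizes and $m_i\ge 1$ the multiplicity of $L_i$. Gaps: $g_i=L_i-L_{i+1}$ for $1\le i<r$ and $g_r=L_r$. Set $A(\lambda):=\#\{i:g_i>1\}$ and $B(\lambda):=\#\{i:m_i>1\}$. Partition graph: for $n\ge 1$, $G_n$ is the simple graph whose vertices are the integer partitions of $n$; two distinct partitions are adjacent if one is obtained from the other by an elementary transfer of one unit from one part to another (subtract $1$ from one part and add $1$ to another part), followed by reordering. Here the receiving part may be a zero part (so a new part $1$ may be created), and parts that become $0$ are discarded. $\deg(\lambda)$ is the degree of $\lambda$ in $G_n$, $\Delta_n:=\max_{\lambda\vdash n}\deg(\lambda)$, $M_n:=\{\lambda\vdash n:\deg(\lambda)=\Delta_n\}$, $\Pi_n:=\{(A(\lambda),B(\lambda)):\lambda\in M_n\}$, $M_n^{(a,b)}:=\{\lambda\in M_n:(A(\lambda),B(\lambda))=(a,b)\}$, and $m_n^{\mathrm{sc}}:=|\{\lambda\in M_n:\lambda=\lambda'\}|$, where $\lambda'$ is the conjugate partition. *)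

theory Defs
  imports "HOL-Library.Multiset"
begin

definition triangular :: "nat \<Rightarrow> nat" where
  "triangular m = m * (m + 1) div 2"

text \<open>An integer partition is the multiset of its (positive) parts.\<close>

definition partitions :: "nat \<Rightarrow> nat multiset set" where
  "partitions n = {p. 0 \<notin># p \<and> sum_mset p = n}"

text \<open>The distinct part sizes \<open>L\<^sub>1 > \<dots> > L\<^sub>r\<close> of the compressed form, as a 0-indexed list;
  the multiplicity of \<open>L\<^sub>i\<close> is \<open>count p L\<^sub>i\<close>.\<close>

definition part_sizes :: "nat multiset \<Rightarrow> nat list" where
  "part_sizes p = rev (sorted_list_of_set (set_mset p))"

definition gap :: "nat multiset \<Rightarrow> nat \<Rightarrow> nat" where
  "gap p i =
     (if Suc i < length (part_sizes p) then part_sizes p ! i - part_sizes p ! Suc i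
      else part_sizes p ! i)"

definition num_large_gaps :: "nat multiset \<Rightarrow> nat" where
  "num_large_gaps p = card {i. i < length (part_sizes p) \<and> gap p i > 1}"

definition num_repeated :: "nat multiset \<Rightarrow> nat" where
  "num_repeated p = card {i. i < length (part_sizes p) \<and> count p (part_sizes p ! i) > 1}"

text \<open>A unit moves from a part \<open>a\<close> to another part \<open>b\<close> (another occurrence: \<open>a = b\<close> is possible
  if this size is repeated). Adjoining a single \<open>0\<close> to \<open>p\<close> allows for the creation of a new
  part \<open>1\<close>; parts \<open>0\<close> are discarded afterwards.\<close>

definition unit_transfer :: "nat multiset \<Rightarrow> nat multiset \<Rightarrow> bool" where
  "unit_transfer p q \<longleftrightarrow>
     (\<exists>a b. 0 < a \<and> {#a, b#} \<subseteq># add_mset 0 p \<and>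
        q = filter_mset (\<lambda>x. 0 < x) (add_mset 0 p - {#a, b#} + {#a - 1, b + 1#}))"

definition partition_adj :: "nat multiset \<Rightarrow> nat multiset \<Rightarrow> bool" where
  "partition_adj p q \<longleftrightarrow> p \<noteq> q \<and> (unit_transfer p q \<or> unit_transfer q p)"

definition partition_deg :: "nat \<Rightarrow> nat multiset \<Rightarrow> nat" where
  "partition_deg n p = card {q \<in> partitions n. partition_adj p q}"

definition max_deg :: "nat \<Rightarrow> nat" where
  "max_deg n = Max (partition_deg n ` partitions n)"

definition max_deg_partitions :: "nat \<Rightarrow> nat multiset set" where
  "max_deg_partitions n = {p \<in> partitions n. partition_deg n p = max_deg n}"

definition max_deg_types :: "nat \<Rightarrow> (nat \<times> nat) set" where
  "max_deg_types n = (\<lambda>p. (num_large_gaps p, num_repeated p)) ` max_deg_partitions n"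

definition max_deg_partitions_of_type :: "nat \<Rightarrow> nat \<times> nat \<Rightarrow> nat multiset set" where
  "max_deg_partitions_of_type n ab =
     {p \<in> max_deg_partitions n. (num_large_gaps p, num_repeated p) = ab}"

text \<open>The \<open>j\<close>-th part of the conjugate is the number of parts that are at least \<open>j\<close>, for every
  \<open>j \<ge> 1\<close> up to the largest part.\<close>

definition conjugate_partition :: "nat multiset \<Rightarrow> nat multiset" where
  "conjugate_partition p =
     image_mset (\<lambda>j. size {#x \<in># p. j \<le> x#}) (mset_set {j. 1 \<le> j \<and> (\<exists>x \<in># p. j \<le> x)})"

definition num_self_conj_max :: "nat \<Rightarrow> nat" where
  "num_self_conj_max n = card {p \<in> max_deg_partitions n. p = conjugate_partition p}"

text \<open>\<open>Max\<close> and \<open>card\<close> are only meaningful on finite sets.\<close>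

lemma finite_partitions: "finite (partitions n)"
proof (rule finite_subset)
  show "partitions n \<subseteq> mset ` {xs. set xs \<subseteq> {..n} \<and> length xs \<le> n}"
  proof
    fix p assume p: "p \<in> partitions n"
    obtain xs where xs: "p = mset xs" by (metis ex_mset)
    have "length xs \<le> sum_list xs" if "0 \<notin> set xs" for xs :: "nat list"
      using that by (induction xs) auto
    moreover have "x \<le> sum_list xs" if "x \<in> set xs" for x :: nat
      using that by (intro member_le_sum_list) auto
    ultimately have "set xs \<subseteq> {..n} \<and> length xs \<le> n"
      using p xs by (auto simp: partitions_def sum_mset_sum_list)
    then show "p \<in> mset ` {xs. set xs \<subseteq> {..n} \<and> length xs \<le> n}"
      using xs by blast
  qed
  show "finite (mset ` {xs. set xs \<subseteq> {..n} \<and> length xs \<le> n})"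
    by (intro finite_imageI finite_lists_length_le) simp
qed

end

theory Submission
  imports Defs
begin

text \<open>A transfer from a part of size \<open>a\<close> to one of size \<open>b\<close> changes the partition iff \<open>a \<noteq> b + 1\<close>, and
  different such pairs give different neighbours. Hence a partition with \<open>r\<close> distinct part sizes has
  degree \<open>r\<^sup>2 - r + A + B\<close>. As \<open>A, B \<le> r\<close> and \<open>r \<le> s\<close>, the case \<open>r < s\<close> only gives degrees up
  to \<open>s\<^sup>2 - s\<close>. A partition with \<open>r = s\<close> is the staircase \<open>s, \<dots>, 1\<close> decorated by a multiset \<open>W\<close> of gap
  indices and a multiset \<open>E\<close> of extra parts of total weight \<open>5\<close>, where \<open>A\<close> and \<open>B\<close> count the distinct
  elements of \<open>W\<close> and of \<open>E\<close>. Among the pairs of weight \<open>5\<close>, \<open>A + B\<close> is at most \<open>3\<close>, and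
  eight pairs attain \<open>3\<close>. Conjugation exchanges \<open>A\<close> and \<open>B\<close>, so a self-conjugate partition has
  \<open>A = B\<close>.\<close>

section \<open>Transfers and the neighbours they produce\<close>

definition parts_ge :: "nat multiset \<Rightarrow> nat \<Rightarrow> nat" where
  "parts_ge p j = size {#x \<in># p. j \<le> x#}"

definition transfer :: "nat multiset \<Rightarrow> nat \<Rightarrow> nat \<Rightarrow> nat multiset" where
  "transfer p a b = filter_mset (\<lambda>x. 0 < x) (add_mset 0 p - {#a, b#} + {#a - 1, b + 1#})"

definition moves :: "nat multiset \<Rightarrow> (nat \<times> nat) set" where
  "moves p = {(a, b). 0 < a \<and> {#a, b#} \<subseteq># add_mset 0 p \<and> a \<noteq> b + 1}"

lemma filter_pos_id: "0 \<notin># p \<Longrightarrow> filter_mset (\<lambda>x::nat. 0 < x) p = p"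
  by (metis (mono_tags, lifting) filter_mset_cong filter_mset_True gr0I)

lemma filter_pos_in_partitions: "filter_mset (\<lambda>x. 0 < x) p \<in> partitions n \<longleftrightarrow> sum_mset p = n"
proof -
  have "sum_mset (filter_mset (\<lambda>x. 0 < x) p) = sum_mset p"
    by (induction p) auto
  then show ?thesis by (simp add: partitions_def)
qed

lemma transfer_in_partitions:
  assumes "p \<in> partitions n" "0 < a" "{#a, b#} \<subseteq># add_mset 0 p"
  shows "transfer p a b \<in> partitions n"
proof -
  obtain R where R: "add_mset 0 p = {#a, b#} + R"
    using assms(3) by (metis subset_mset.add_diff_inverse)
  have "sum_mset (add_mset 0 p) = n"
    using assms(1) by (simp add: partitions_def)
  then have "a + b + sum_mset R = n"
    by (simp add: R)
  then have "sum_mset (add_mset 0 p - {#a, b#} + {#a - 1, b + 1#}) = n"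
    using assms(2) by (simp add: R)
  then show ?thesis
    unfolding transfer_def filter_pos_in_partitions .
qed

text \<open>The numbers \<open>parts_ge\<close> of a partition determine \<open>a\<close> and \<open>b + 1\<close> as the only places where
  they drop or grow.\<close>

lemma parts_ge_transfer:
  assumes "0 < j" "0 < a" "{#a, b#} \<subseteq># add_mset 0 p"
  shows "parts_ge (transfer p a b) j + (if j = a then 1 else 0)
    = parts_ge p j + (if j = b + 1 then 1 else 0)"
proof -
  obtain R where R: "add_mset 0 p = {#a, b#} + R"
    using assms(3) by (metis subset_mset.add_diff_inverse)
  \<comment> \<open>As \<open>j\<close> is positive, neither the adjoined zero nor the discarded
    zeros are counted.\<close>
  have "parts_ge (transfer p a b) j = parts_ge ({#a - 1, b + 1#} + R) j"
    unfolding parts_ge_def transfer_def filter_filter_mset R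
    using assms(1) by (intro arg_cong[of _ _ size]) (auto intro!: filter_mset_cong)
  moreover have "parts_ge p j = parts_ge ({#a, b#} + R) j"
    using assms(1) unfolding R[symmetric] by (simp add: parts_ge_def)
  ultimately show ?thesis
    using assms(1,2) by (auto simp: parts_ge_def)
qed

text \<open>Here \<open>{#a - 1, b + 1#}\<close> is \<open>{#a, b#}\<close> again: the two parts
  merely swap their sizes.\<close>

lemma transfer_trivial:
  assumes "0 \<notin># p" "0 < a" "{#a, b#} \<subseteq># add_mset 0 p" "a = b + 1"
  shows "transfer p a b = p"
proof -
  have "add_mset 0 p - {#a, b#} + {#a - 1, b + 1#} = add_mset 0 p"
    using assms(3,4) by (metis add_diff_cancel_right' add_mset_commute subset_mset.diff_add)
  then show ?thesis
    using assms(1) by (simp add: transfer_def filter_pos_id del: filter_union_mset)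
qed

lemma transfer_neq:
  assumes "0 < a" "{#a, b#} \<subseteq># add_mset 0 p" "a \<noteq> b + 1"
  shows "transfer p a b \<noteq> p"
  using parts_ge_transfer[OF assms(1) assms(1,2)] assms(3) by auto

lemma transfer_inj: "inj_on (\<lambda>(a, b). transfer p a b) (moves p)"
proof -
  have *: "a = c \<and> b = d"
    if m: "(a, b) \<in> moves p" "(c, d) \<in> moves p" and eq: "transfer p a b = transfer p c d"
    for a b c d
  proof -
    have "a = c"
      using m parts_ge_transfer[of a a b p] parts_ge_transfer[of a c d p] eq
      by (auto simp: moves_def split: if_splits)
    moreover have "b + 1 = d + 1"
      using m parts_ge_transfer[of "b + 1" a b p] parts_ge_transfer[of "b + 1" c d p] eq
      by (auto simp: moves_def split: if_splits)
    ultimately show ?thesis by simp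
  qed
  then show ?thesis
    by (auto simp: inj_on_def)
qed

text \<open>The unit is sent back from \<open>b + 1\<close> to \<open>a - 1\<close>. Hence the
  neighbours of \<open>p\<close> are already given by the transfers that start at
  \<open>p\<close>.\<close>

lemma unit_transfer_sym:
  assumes "0 \<notin># p" "unit_transfer p q"
  shows "unit_transfer q p"
proof -
  let ?P = "filter_mset (\<lambda>x::nat. 0 < x)"
  obtain a b where ab: "0 < a" "{#a, b#} \<subseteq># add_mset 0 p" "q = transfer p a b"
    using assms(2) by (auto simp: unit_transfer_def transfer_def)
  obtain R where R: "add_mset 0 p = {#a, b#} + R"
    using ab(2) by (metis subset_mset.add_diff_inverse)
  have q: "q = ?P ({#b + 1, a - 1#} + R)"
    unfolding ab(3) transfer_def R by simp
  have "p = ?P ({#a, b#} + R)"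
    unfolding R[symmetric] using assms(1) by (simp add: filter_pos_id)
  also have "\<dots> = ?P (add_mset 0 q - {#b + 1, a - 1#} + {#b + 1 - 1, a - 1 + 1#})"
    using ab(1) by (simp add: q filter_diff_mset filter_filter_mset)
  finally have "p = \<dots>" .
  \<comment> \<open>For \<open>a = 1\<close> the emptied part was discarded, and the zero adjoined
    to \<open>q\<close> takes its place.\<close>
  moreover have "{#b + 1, a - 1#} \<subseteq># add_mset 0 q"
    using ab(1) by (cases "a = 1") (auto simp: q)
  ultimately show ?thesis
    unfolding unit_transfer_def by (intro exI[of _ "b + 1"] exI[of _ "a - 1"]) simp
qed

lemma neighbours_eq:
  assumes "p \<in> partitions n"
  shows "{q \<in> partitions n. partition_adj p q} = (\<lambda>(a, b). transfer p a b) ` moves p"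
proof -
  have 0: "0 \<notin># q" if "q \<in> partitions n" for q
    using that by (simp add: partitions_def)
  have ut: "unit_transfer p q \<longleftrightarrow>
      (\<exists>a b. 0 < a \<and> {#a, b#} \<subseteq># add_mset 0 p \<and> q = transfer p a b)" for q
    by (simp add: unit_transfer_def transfer_def)
  have "{q \<in> partitions n. partition_adj p q} = {q \<in> partitions n. p \<noteq> q \<and> unit_transfer p q}"
    using unit_transfer_sym 0 assms by (auto simp: partition_adj_def)
  also have "\<dots> = (\<lambda>(a, b). transfer p a b) ` moves p"
  proof (intro set_eqI iffI)
    fix q assume q: "q \<in> {q \<in> partitions n. p \<noteq> q \<and> unit_transfer p q}"
    then obtain a b where "0 < a" "{#a, b#} \<subseteq># add_mset 0 p" "q = transfer p a b"
      by (auto simp: ut)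
    moreover from this have "a \<noteq> b + 1"
      using transfer_trivial q 0[OF assms] by auto
    ultimately show "q \<in> (\<lambda>(a, b). transfer p a b) ` moves p"
      by (auto simp: moves_def)
  next
    fix q assume "q \<in> (\<lambda>(a, b). transfer p a b) ` moves p"
    then obtain a b where ab: "0 < a" "{#a, b#} \<subseteq># add_mset 0 p" "q = transfer p a b" "a \<noteq> b + 1"
      by (auto simp: moves_def)
    then show "q \<in> {q \<in> partitions n. p \<noteq> q \<and> unit_transfer p q}"
      using transfer_in_partitions[OF assms ab(1,2)] transfer_neq[OF ab(1,2,4)]
      by (auto simp: ut)
  qed
  finally show ?thesis .
qed

section \<open>Counting the moves: the degree formula\<close>

lemma mem_moves:
  assumes "0 \<notin># p"
  shows "(a, b) \<in> moves p \<longleftrightarrow> a \<in># p \<and> b \<in> insert 0 (set_mset p) \<and>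
    \<not> (a = b \<and> count p a = 1) \<and> a \<noteq> b + 1"
proof -
  have c0: "count p 0 = 0" using assms by (simp add: not_in_iff)
  have "0 < a \<and> {#a, b#} \<subseteq># add_mset 0 p \<longleftrightarrow>
      a \<in># p \<and> b \<in> insert 0 (set_mset p) \<and> \<not> (a = b \<and> count p a = 1)"
  proof (cases "a = b")
    case True
    show ?thesis
    proof (cases "a = 0")
      case False
      have "{#a, a#} \<subseteq># add_mset 0 p \<longleftrightarrow> 2 \<le> count p a"
        using False by (auto simp: subseteq_mset_def)
      moreover have "2 \<le> count p a \<longleftrightarrow> a \<in># p \<and> count p a \<noteq> 1"
        by (auto simp flip: count_greater_zero_iff)
      ultimately show ?thesis using True False by auto
    qed (use True assms in auto)
  next
    case False
    have "{#a, b#} \<subseteq># add_mset 0 p \<longleftrightarrow> a \<in># add_mset 0 p \<and> b \<in># add_mset 0 p"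
      using False by (auto simp: insert_subset_eq_iff in_diff_count)
    then show ?thesis using False assms by (auto intro: gr0I)
  qed
  then show ?thesis by (auto simp: moves_def)
qed

text \<open>With r = \<open>card S\<close>, the moves are the r(r + 1) pairs in
  \<open>S \<times> insert 0 S\<close> without two disjoint sets: the diagonal pairs of sizes that
  occur only once (\<open>D1\<close>, r - B pairs) and the trivial pairs \<open>a = b + 1\<close>
  (\<open>D2\<close>, r - A pairs). The additive form avoids truncated subtraction.\<close>

lemma card_moves:
  assumes "0 \<notin># p"
  defines "S \<equiv> set_mset p"
  shows "card (moves p) + card S
    = card S * card S + card {a \<in> S. a - 1 \<notin> insert 0 S} + card {a \<in> S. count p a > 1}"
proof -
  define D1 where "D1 = {(a, b). a \<in> S \<and> b = a \<and> count p a = 1}"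
  define D2 where "D2 = {(a, b). a \<in> S \<and> b \<in> insert 0 S \<and> a = b + 1}"
  have fin: "finite S" by (simp add: S_def)
  have pos: "0 < a" if "a \<in> S" for a using that assms(1) by (auto simp: S_def intro: gr0I)
  have un: "S \<times> insert 0 S = moves p \<union> (D1 \<union> D2)"
    using mem_moves[OF assms(1)] by (auto simp: D1_def D2_def S_def)
  have dis: "moves p \<inter> (D1 \<union> D2) = {}" "D1 \<inter> D2 = {}"
    using mem_moves[OF assms(1)] by (auto simp: D1_def D2_def S_def)
  have "finite (moves p \<union> (D1 \<union> D2))"
    using fin unfolding un[symmetric] by simp
  then have finD: "finite (moves p)" "finite D1" "finite D2"
    by simp_all
  have "card (S \<times> insert 0 S) = card (moves p) + (card D1 + card D2)"
    unfolding un using dis finD by (simp add: card_Un_disjoint)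
  moreover have "card (S \<times> insert 0 S) = card S * card S + card S"
    using assms(1) fin by (simp add: card_cartesian_product S_def)
  moreover have "card D1 + card {a \<in> S. count p a > 1} = card S"
  proof -
    have "D1 = (\<lambda>a. (a, a)) ` {a \<in> S. count p a = 1}"
      by (auto simp: D1_def)
    then have "card D1 = card {a \<in> S. count p a = 1}"
      by (simp add: card_image inj_on_def)
    moreover have "S = {a \<in> S. count p a = 1} \<union> {a \<in> S. count p a > 1}"
      by (auto simp: S_def simp flip: count_greater_zero_iff)
    then have "card S = card {a \<in> S. count p a = 1} + card {a \<in> S. count p a > 1}"
      using fin by (subst card_Un_disjoint[symmetric]) auto
    ultimately show ?thesis by simp
  qed
  moreover have "card D2 + card {a \<in> S. a - 1 \<notin> insert 0 S} = card S"
  proof -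
    have "D2 = (\<lambda>a. (a, a - 1)) ` {a \<in> S. a - 1 \<in> insert 0 S}"
      using pos by (force simp: D2_def)
    then have "card D2 = card {a \<in> S. a - 1 \<in> insert 0 S}"
      by (simp add: card_image inj_on_def)
    moreover have "S = {a \<in> S. a - 1 \<in> insert 0 S} \<union> {a \<in> S. a - 1 \<notin> insert 0 S}"
      by blast
    then have "card S = card {a \<in> S. a - 1 \<in> insert 0 S} + card {a \<in> S. a - 1 \<notin> insert 0 S}"
      using fin by (subst card_Un_disjoint[symmetric]) auto
    ultimately show ?thesis by simp
  qed
  ultimately show ?thesis by linarith
qed

lemma part_sizes_nth_less:
  "i < j \<Longrightarrow> j < length (part_sizes p) \<Longrightarrow> part_sizes p ! j < part_sizes p ! i"
proof -
  have "sorted_wrt (>) (part_sizes p)"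
    by (simp add: part_sizes_def sorted_wrt_rev)
  then show "i < j \<Longrightarrow> j < length (part_sizes p) \<Longrightarrow> part_sizes p ! j < part_sizes p ! i"
    by (simp add: sorted_wrt_iff_nth_less)
qed

lemma set_part_sizes [simp]: "set (part_sizes p) = set_mset p"
  by (simp add: part_sizes_def)

lemma length_part_sizes [simp]: "length (part_sizes p) = card (set_mset p)"
  by (simp add: part_sizes_def)

lemma bij_betw_part_sizes: "bij_betw ((!) (part_sizes p)) {..<card (set_mset p)} (set_mset p)"
  by (rule bij_betw_nth) (simp_all add: part_sizes_def)

lemma card_indices:
  "card {i. i < length (part_sizes p) \<and> P (part_sizes p ! i)} = card {a \<in> set_mset p. P a}"
proof -
  have "bij_betw ((!) (part_sizes p)) {i \<in> {..<card (set_mset p)}. P (part_sizes p ! i)}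
      {a \<in> set_mset p. P a}"
    using bij_betw_part_sizes[of p] by (auto simp: bij_betw_def inj_on_def)
  then show ?thesis by (auto dest: bij_betw_same_card)
qed

lemma num_repeated_eq: "num_repeated p = card {a \<in> set_mset p. count p a > 1}"
  unfolding num_repeated_def by (rule card_indices)

text \<open>The only candidate for a part of size \<open>part_sizes p ! i - 1\<close> is the next
  smaller size. The smallest size has its own value as gap, so it is compared with 0; hence the
  \<open>insert 0\<close>.\<close>

lemma gap_gt_1_iff:
  assumes "0 \<notin># p" "i < length (part_sizes p)"
  shows "gap p i > 1 \<longleftrightarrow> part_sizes p ! i - 1 \<notin> insert 0 (set_mset p)"
proof -
  let ?L = "part_sizes p"
  have pos: "0 < ?L ! j" if "j < length ?L" for j
    using nth_mem[OF that] assms(1) by (auto intro: gr0I)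
  have idx: "\<exists>j < length ?L. ?L ! j = x" if "x \<in># p" for x
    using that by (metis in_set_conv_nth set_part_sizes)
  show ?thesis
  proof (cases "Suc i < length ?L")
    case True
    have lt: "?L ! Suc i < ?L ! i" using part_sizes_nth_less[of i "Suc i"] True by simp
    have "?L ! i - 1 = ?L ! Suc i" if mem: "?L ! i - 1 \<in># p"
    proof -
      obtain j where j: "j < length ?L" "?L ! j = ?L ! i - 1" using idx[OF mem] by auto
      \<comment> \<open>The size one below comes after index \<open>i\<close>. Were it beyond
        \<open>Suc i\<close>, then the size at \<open>Suc i\<close> would lie strictly between two
        consecutive integers.\<close>
      have "i < j"
        using part_sizes_nth_less[of j i p] j pos[OF assms(2)] assms(2)
        by (metis diff_less less_irrefl less_one linorder_neqE_nat not_less_iff_gr_or_eq)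
      then have "j = Suc i \<or> ?L ! j < ?L ! Suc i"
        using part_sizes_nth_less[of "Suc i" j p] j by linarith
      then show ?thesis using j lt by auto
    qed
    moreover have "?L ! Suc i \<in># p" using nth_mem[OF True] by simp
    ultimately show ?thesis
      using True lt pos[OF True] by (cases "?L ! i = Suc (?L ! Suc i)") (auto simp: gap_def)
  next
    case False
    have "?L ! i - 1 \<notin># p"
    proof
      assume "?L ! i - 1 \<in># p"
      then obtain j where j: "j < length ?L" "?L ! j = ?L ! i - 1" using idx by auto
      then show False
        using part_sizes_nth_less[of j i p] False pos[OF assms(2)] assms(2)
        by (metis Suc_lessI diff_less less_Suc_eq less_imp_diff_less less_numeral_extra(1) less_irrefl not_less_eq)
    qed
    then show ?thesis using False by (auto simp: gap_def)
  qed
qed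

lemma num_large_gaps_eq:
  assumes "0 \<notin># p"
  shows "num_large_gaps p = card {a \<in> set_mset p. a - 1 \<notin> insert 0 (set_mset p)}"
proof -
  have "num_large_gaps p
      = card {i. i < length (part_sizes p) \<and> part_sizes p ! i - 1 \<notin> insert 0 (set_mset p)}"
    unfolding num_large_gaps_def using gap_gt_1_iff[OF assms] by metis
  also have "\<dots> = card {a \<in> set_mset p. a - 1 \<notin> insert 0 (set_mset p)}"
    by (rule card_indices)
  finally show ?thesis .
qed

lemma partition_deg_eq:
  assumes "p \<in> partitions n"
  shows "partition_deg n p + card (set_mset p)
    = card (set_mset p) * card (set_mset p) + num_large_gaps p + num_repeated p"
proof -
  have 0: "0 \<notin># p" using assms by (simp add: partitions_def)
  have "partition_deg n p = card (moves p)"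
    unfolding partition_deg_def neighbours_eq[OF assms] by (rule card_image[OF transfer_inj])
  then show ?thesis
    using card_moves[OF 0] by (simp add: num_large_gaps_eq[OF 0] num_repeated_eq)
qed

section \<open>Partitions with s distinct sizes as decorated staircases\<close>

definition shifted_staircase :: "nat \<Rightarrow> nat multiset \<Rightarrow> nat \<Rightarrow> nat" where
  "shifted_staircase s W k = s - k + size {#w \<in># W. k < w#}"

text \<open>\<open>W\<close> records the gaps: the multiplicity of \<open>i\<close> in \<open>W\<close> is \<open>g\<^sub>i - 1\<close>. Widening the \<open>i\<close>-th gap
  by one shifts the \<open>i\<close> largest parts, hence an element \<open>i\<close> of \<open>W\<close> adds \<open>i\<close> to the sum. \<open>E\<close> records
  the repeated copies of parts.\<close>

definition decorated_staircase :: "nat \<Rightarrow> nat multiset \<Rightarrow> nat multiset \<Rightarrow> nat multiset" where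
  "decorated_staircase s W E = mset_set (shifted_staircase s W ` {..<s}) + E"

definition decorations :: "nat \<Rightarrow> (nat multiset \<times> nat multiset) set" where
  "decorations s = {(W, E). set_mset W \<subseteq> {1..s} \<and> set_mset E \<subseteq> shifted_staircase s W ` {..<s}}"

text \<open>Exactly the copies of \<open>Suc k\<close> in \<open>W\<close> are counted at
  \<open>k\<close> but not at \<open>Suc k\<close>. Indices of parts start at 0, elements of
  \<open>W\<close> at 1.\<close>

lemma shifted_staircase_Suc:
  assumes "k < s"
  shows "shifted_staircase s W k = shifted_staircase s W (Suc k) + 1 + count W (Suc k)"
proof -
  have "size {#w \<in># W. k < w#} = size {#w \<in># W. Suc k < w#} + count W (Suc k)"
    by (induction W) auto
  then show ?thesis
    using assms by (simp add: shifted_staircase_def)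
qed

text \<open>Index \<open>s\<close> stands for an additional size 0 below the smallest part, so that
  the last gap becomes a difference like all others.\<close>

lemma shifted_staircase_end:
  assumes "set_mset W \<subseteq> {1..s}"
  shows "shifted_staircase s W s = 0"
proof -
  have "{#w \<in># W. s < w#} = {#}"
    using assms by (auto simp: not_less)
  then show ?thesis by (simp add: shifted_staircase_def)
qed

lemma shifted_staircase_less:
  "j < k \<Longrightarrow> k \<le> s \<Longrightarrow> shifted_staircase s W k < shifted_staircase s W j"
proof (induction k)
  case (Suc k)
  then show ?case
    using shifted_staircase_Suc[of k s W] by (cases "j = k") auto
qed simp

lemma inj_on_shifted_staircase: "inj_on (shifted_staircase s W) {..<s}"
proof (rule linorder_inj_onI)
  fix j k assume "j < k" "j \<in> {..<s}" "k \<in> {..<s}"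
  then show "shifted_staircase s W j \<noteq> shifted_staircase s W k"
    using shifted_staircase_less[of j k s W] by simp
qed auto

lemma sum_staircase: "(\<Sum>k<s. s - k) = triangular s"
proof (induction s)
  case (Suc s)
  have "(\<Sum>k<Suc s. Suc s - k) = Suc s + (\<Sum>k<s. s - k)"
    by (subst sum.lessThan_Suc_shift) simp
  then show ?case using Suc by (simp add: triangular_def)
qed (simp add: triangular_def)

text \<open>Double counting: an element \<open>w\<close> of \<open>W\<close> contributes one at each
  of the \<open>w\<close> indices \<open>k < w\<close>, and \<open>w \<le> s\<close> ensures that
  all of them are summed over.\<close>

lemma sum_shifted_staircase:
  assumes "set_mset W \<subseteq> {1..s}"
  shows "(\<Sum>k<s. shifted_staircase s W k) = triangular s + sum_mset W"
proof -
  have "(\<Sum>k<s. size {#w \<in># W. k < w#}) = sum_mset W"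
    using assms
  proof (induction W)
    case (add w W)
    have "(\<Sum>k<s. if k < w then 1 else 0) = card ({..<s} \<inter> {k. k < w})"
      by (simp add: sum.If_cases)
    also have "{..<s} \<inter> {k. k < w} = {..<w}"
      using add.prems by auto
    finally have "(\<Sum>k<s. if k < w then 1 else 0) = w" by simp
    moreover have "size {#v \<in># add_mset w W. k < v#}
        = (if k < w then 1 else 0) + size {#v \<in># W. k < v#}" for k
      by simp
    ultimately show ?case
      using add by (simp only: sum.distrib) simp
  qed simp
  then show ?thesis
    unfolding shifted_staircase_def sum.distrib by (simp add: sum_staircase)
qed

context
  fixes s W E
  assumes WE: "(W, E) \<in> decorations s"
begin

lemma indices_bounded: "set_mset W \<subseteq> {1..s}"
  and extra_parts: "set_mset E \<subseteq> shifted_staircase s W ` {..<s}"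
  using WE by (simp_all add: decorations_def)

lemma set_decorated_staircase:
  "set_mset (decorated_staircase s W E) = shifted_staircase s W ` {..<s}"
  using extra_parts by (auto simp: decorated_staircase_def)

lemma card_decorated_staircase: "card (set_mset (decorated_staircase s W E)) = s"
  using inj_on_shifted_staircase by (simp add: set_decorated_staircase card_image)

lemma decorated_staircase_in_partitions:
  "decorated_staircase s W E \<in> partitions (triangular s + sum_mset W + sum_mset E)"
proof -
  have "0 < shifted_staircase s W k" if "k < s" for k
    using shifted_staircase_less[OF that order_refl] by (metis bot_nat_0.extremum_strict gr_zeroI)
  then have "0 \<notin># decorated_staircase s W E"
    unfolding set_decorated_staircase by (metis imageE lessThan_iff less_irrefl)
  moreover have "sum_mset (decorated_staircase s W E) = triangular s + sum_mset W + sum_mset E"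
    using sum_shifted_staircase[OF indices_bounded]
    by (simp add: decorated_staircase_def sum_unfold_sum_mset
        flip: image_mset_mset_set[OF inj_on_shifted_staircase])
  ultimately show ?thesis by (simp add: partitions_def)
qed

lemma part_sizes_decorated_staircase:
  "part_sizes (decorated_staircase s W E) = map (shifted_staircase s W) [0..<s]"
proof -
  have "sorted_wrt (<) (rev (map (shifted_staircase s W) [0..<s]))"
    unfolding sorted_wrt_rev
    by (auto simp: sorted_wrt_iff_nth_less intro!: shifted_staircase_less)
  moreover have "set (rev (map (shifted_staircase s W) [0..<s]))
      = set_mset (decorated_staircase s W E)"
    by (auto simp: set_decorated_staircase)
  ultimately have "rev (map (shifted_staircase s W) [0..<s])
      = sorted_list_of_set (set_mset (decorated_staircase s W E))"
    by (intro strict_sorted_equal) auto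
  then show ?thesis by (metis part_sizes_def rev_rev_ident)
qed

lemma gap_decorated_staircase:
  "i < s \<Longrightarrow> gap (decorated_staircase s W E) i = 1 + count W (Suc i)"
  using shifted_staircase_Suc[of i s W] shifted_staircase_end[OF indices_bounded]
  by (cases "Suc i = s") (auto simp: gap_def part_sizes_decorated_staircase)

lemma num_large_gaps_decorated_staircase:
  "num_large_gaps (decorated_staircase s W E) = card (set_mset W)"
proof -
  have "{i. i < s \<and> gap (decorated_staircase s W E) i > 1} = {i. Suc i \<in># W}"
    using indices_bounded gap_decorated_staircase by (force simp: not_in_iff)
  moreover have "set_mset W = Suc ` {i. Suc i \<in># W}"
  proof (intro set_eqI iffI)
    fix w assume "w \<in># W"
    then show "w \<in> Suc ` {i. Suc i \<in># W}"
      using indices_bounded by (cases w) auto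
  qed auto
  then have "card (set_mset W) = card {i. Suc i \<in># W}"
    by (metis card_image inj_Suc inj_on_subset subset_UNIV)
  ultimately show ?thesis
    by (simp add: num_large_gaps_def part_sizes_decorated_staircase)
qed

text \<open>Each size occurs once in the staircase itself, so it is repeated exactly if
  \<open>E\<close> contains it.\<close>

lemma num_repeated_decorated_staircase:
  "num_repeated (decorated_staircase s W E) = card (set_mset E)"
proof -
  have "{a \<in> set_mset (decorated_staircase s W E). count (decorated_staircase s W E) a > 1}
      = set_mset E"
    using extra_parts unfolding set_decorated_staircase
    by (auto simp: decorated_staircase_def simp flip: count_greater_zero_iff)
  then show ?thesis by (simp add: num_repeated_eq)
qed

end

text \<open>The gaps of the partition determine \<open>W\<close>, hence the staircase; cancelling
  the staircase leaves \<open>E\<close>.\<close>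

lemma inj_on_decorated_staircase: "inj_on (\<lambda>(W, E). decorated_staircase s W E) (decorations s)"
proof -
  have "W = W' \<and> E = E'"
    if dec: "(W, E) \<in> decorations s" "(W', E') \<in> decorations s"
      and eq: "decorated_staircase s W E = decorated_staircase s W' E'" for W E W' E'
  proof -
    have "count W v = count W' v" for v
    proof (cases "v \<in> {1..s}")
      case True
      then obtain i where "v = Suc i" "i < s" by (cases v) auto
      then show ?thesis
        using gap_decorated_staircase[OF dec(1)] gap_decorated_staircase[OF dec(2)] eq
        by (metis add_left_cancel)
    next
      case False
      then show ?thesis
        using indices_bounded[OF dec(1)] indices_bounded[OF dec(2)] by (metis not_in_iff subsetD)
    qed
    then have "W = W'" by (rule multiset_eqI)
    then show ?thesis using eq by (simp add: decorated_staircase_def)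
  qed
  then show ?thesis by (auto simp: inj_on_def)
qed

text \<open>The excesses of the gaps over 1 form \<open>W\<close>, and removing one copy of each
  size leaves \<open>E\<close>. With injectivity, decorations parametrize the partitions with a
  given number of distinct sizes.\<close>

lemma obtain_decoration:
  assumes "0 \<notin># p"
  obtains W E where "(W, E) \<in> decorations (card (set_mset p))"
    "p = decorated_staircase (card (set_mset p)) W E"
proof
  let ?s = "card (set_mset p)" and ?L = "part_sizes p"
  define W where "W = (\<Sum>i<?s. replicate_mset (gap p i - 1) (Suc i))"
  let ?E = "p - mset_set (set_mset p)"
  have cW: "count W (Suc k) = gap p k - 1" if "k < ?s" for k
  proof -
    have "count W (Suc k) = (\<Sum>i<?s. if i = k then gap p k - 1 else 0)"
      unfolding W_def count_sum by (intro sum.cong) auto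
    then show ?thesis using that by simp
  qed
  have W: "set_mset W \<subseteq> {1..?s}"
  proof
    fix w assume "w \<in># W"
    then obtain i where "i < ?s" "w \<in># replicate_mset (gap p i - 1) (Suc i)"
      by (auto simp: W_def set_mset_sum)
    then show "w \<in> {1..?s}" by (auto split: if_splits)
  qed
  \<comment> \<open>Downward induction from index \<open>?s\<close>, where both sides are 0: equal
    gaps force equal sizes.\<close>
  have L: "shifted_staircase ?s W k = (if k < ?s then ?L ! k else 0)" if "k \<le> ?s" for k
    using that
  proof (induction rule: inc_induct)
    case base
    then show ?case using shifted_staircase_end[OF W] by simp
  next
    case (step k)
    have "?L ! k \<in># p" using nth_mem[of k ?L] step.hyps by simp
    then have "0 < ?L ! k" using assms by (auto intro: gr0I)
    moreover have "?L ! Suc k < ?L ! k" if "Suc k < ?s"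
      using that by (intro part_sizes_nth_less) auto
    ultimately show ?case
      using step shifted_staircase_Suc[of k ?s W] cW[of k] by (auto simp: gap_def)
  qed
  have S: "shifted_staircase ?s W ` {..<?s} = set_mset p"
    using bij_betw_part_sizes[of p] L by (force simp: bij_betw_def)
  have sub: "mset_set (set_mset p) \<subseteq># p"
    by (rule mset_set_set_mset_msubset)
  show "(W, ?E) \<in> decorations ?s"
    using W by (auto simp: decorations_def S dest: in_diffD)
  show "p = decorated_staircase ?s W ?E"
    using sub by (simp add: decorated_staircase_def S)
qed

text \<open>Elements of \<open>W\<close> are at most \<open>sum_mset W\<close>, so the staircase is
  not shifted from that index on. A part \<open>x\<close> of \<open>E\<close> satisfies
  \<open>x + sum_mset W \<le> s\<close> and is therefore still found at index \<open>s - x\<close>.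
  Thus for small weight the side conditions on decorations hold automatically.\<close>

lemma small_decorations:
  assumes "0 \<notin># W" "0 \<notin># E" "sum_mset W + sum_mset E \<le> s"
  shows "(W, E) \<in> decorations s"
proof -
  have le: "x \<le> sum_mset M" if "x \<in># M" for x and M :: "nat multiset"
    using that by (metis le_add1 multi_member_split sum_mset.add_mset)
  have "x \<in> shifted_staircase s W ` {..<s}" if x: "x \<in># E" for x
  proof
    have bounds: "0 < x" "x + sum_mset W \<le> s"
      using x le[OF x] assms by (auto intro: gr0I)
    have "{#w \<in># W. s - x < w#} = {#}"
      using le[of _ W] bounds by (force simp: not_less)
    then show "x = shifted_staircase s W (s - x)"
      using bounds by (simp add: shifted_staircase_def)
    show "s - x \<in> {..<s}" using bounds by simp
  qed
  moreover have "set_mset W \<subseteq> {1..s}"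
    using le[of _ W] assms by (force simp: Suc_le_eq intro: gr0I)
  ultimately show ?thesis by (auto simp: decorations_def)
qed

section \<open>Enumeration of the partitions of 0 to 5\<close>

lemma partitions_rec:
  assumes "0 < n"
  shows "partitions n = (\<Union>x\<in>{1..n}. add_mset x ` partitions (n - x))"
proof (intro set_eqI iffI)
  fix p assume p: "p \<in> partitions n"
  then have "p \<noteq> {#}" using assms by (auto simp: partitions_def)
  then obtain x q where pq: "p = add_mset x q" by (meson multiset_cases)
  then have "x \<in> {1..n}" "q \<in> partitions (n - x)"
    using p by (auto simp: partitions_def Suc_le_eq)
  then show "p \<in> (\<Union>x\<in>{1..n}. add_mset x ` partitions (n - x))"
    using pq by blast
qed (auto simp: partitions_def)

lemma partitions_0: "partitions 0 = {{#}}"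
  by (auto simp: partitions_def) (metis gr0I multiset_nonemptyE)

lemma partitions_1: "partitions 1 = {{#1#}}"
  by (simp add: partitions_rec partitions_0)

lemma partitions_2: "partitions 2 = {{#2#}, {#1, 1#}}"
proof -
  have "{1..2::nat} = {1, 2}" by auto
  then show ?thesis
    using partitions_1 by (simp add: partitions_rec partitions_0 insert_commute)
qed

lemma partitions_3: "partitions 3 = {{#3#}, {#1, 2#}, {#1, 1, 1#}}"
proof -
  have "{1..3::nat} = {1, 2, 3}" by auto
  then show ?thesis
    using partitions_1 partitions_2
    by (auto simp: partitions_rec[of 3] partitions_0 add_mset_commute)
qed

lemma partitions_4: "partitions 4 = {{#4#}, {#1, 3#}, {#2, 2#}, {#1, 1, 2#}, {#1, 1, 1, 1#}}"
proof -
  have "{1..4::nat} = {1, 2, 3, 4}" by auto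
  then show ?thesis
    using partitions_1 partitions_2 partitions_3
    by (auto simp: partitions_rec[of 4] partitions_0 add_mset_commute)
qed

lemma partitions_5:
  "partitions 5 = {{#5#}, {#1, 4#}, {#2, 3#}, {#1, 1, 3#}, {#1, 2, 2#}, {#1, 1, 1, 2#},
    {#1, 1, 1, 1, 1#}}"
proof -
  have "{1..5::nat} = {1, 2, 3, 4, 5}" by auto
  then show ?thesis
    using partitions_1 partitions_2 partitions_3 partitions_4
    by (auto simp: partitions_rec[of 5] partitions_0 add_mset_commute)
qed

section \<open>Conjugation and the exchange of large gaps with repeated parts\<close>

text \<open>Since \<open>parts_ge p\<close> takes the same value at \<open>a - 1\<close> and \<open>a\<close> exactly if \<open>a - 1\<close> is not a part,
  a part \<open>a\<close> above a large gap corresponds to the repeated part \<open>parts_ge p a\<close> of the conjugate.\<close>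

lemma num_repeated_conjugate:
  assumes "0 \<notin># p"
  shows "num_repeated (conjugate_partition p) = num_large_gaps p"
proof -
  let ?N = "parts_ge p"
  define J where "J = {j. 1 \<le> j \<and> (\<exists>x \<in># p. j \<le> x)}"
  define A where "A = {a \<in> set_mset p. a - 1 \<notin> insert 0 (set_mset p)}"
  have "J \<subseteq> {..Max (set_mset p)}"
    by (auto simp: J_def intro: order_trans[OF _ Max_ge])
  then have finJ: "finite J" by (rule finite_subset) simp
  have conj: "conjugate_partition p = image_mset ?N (mset_set J)"
    unfolding conjugate_partition_def J_def parts_ge_def by simp
  have N_Suc: "?N j = ?N (Suc j) + count p j" for j
    unfolding parts_ge_def by (induction p) auto
  have anti: "?N k \<le> ?N j" if "j \<le> k" for j k
  proof -
    have "?N (Suc i) \<le> ?N i" for i using N_Suc[of i] by simp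
    then show ?thesis using that by (rule lift_Suc_antimono_le)
  qed
  have J_iff: "j \<in> J \<longleftrightarrow> 1 \<le> j \<and> 0 < ?N j" for j
    by (auto simp: J_def parts_ge_def simp flip: nonempty_has_size)
  have count: "count (conjugate_partition p) v = card {j \<in> J. ?N j = v}" for v
  proof -
    have "count (conjugate_partition p) v = card (?N -` {v} \<inter> J)"
      using finJ by (simp add: conj count_image_mset)
    also have "?N -` {v} \<inter> J = {j \<in> J. ?N j = v}" by blast
    finally show ?thesis .
  qed
  have "{v \<in> set_mset (conjugate_partition p). count (conjugate_partition p) v > 1} = ?N ` A"
  proof (intro set_eqI iffI)
    fix v assume "v \<in> {v \<in> set_mset (conjugate_partition p). count (conjugate_partition p) v > 1}"
    then have card: "1 < card {j \<in> J. ?N j = v}" by (simp add: count)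
    \<comment> \<open>Since \<open>?N\<close> is antitone, the indices with value \<open>v\<close>
      form an interval. Its top \<open>a\<close> is a part because \<open>?N\<close> drops after it,
      while \<open>a - 1\<close> still lies in the interval, so \<open>?N\<close> is constant from
      \<open>a - 1\<close> to \<open>a\<close>.\<close>
    define a where "a = Max {j \<in> J. ?N j = v}"
    have fin: "finite {j \<in> J. ?N j = v}" using finJ by simp
    have "{j \<in> J. ?N j = v} \<noteq> {}" using card by force
    then have a: "a \<in> J" "?N a = v" using Max_in[OF fin] by (auto simp: a_def)
    have "\<not> {j \<in> J. ?N j = v} \<subseteq> {a}"
      using card card_mono[of "{a}" "{j \<in> J. ?N j = v}"] by auto
    then obtain j where j: "j \<in> J" "?N j = v" "j \<noteq> a" by blast
    have "j < a" using Max_ge[OF fin, of j] j by (auto simp: a_def)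
    have "a \<in># p"
    proof (rule ccontr)
      assume "a \<notin># p"
      then have "?N (Suc a) = v" using N_Suc[of a] a by (simp add: not_in_iff)
      then have "Suc a \<in> {j \<in> J. ?N j = v}" using a by (auto simp: J_iff)
      then show False using Max_ge[OF fin, of "Suc a"] by (simp add: a_def)
    qed
    moreover have "?N (a - 1) = v"
      using anti[of j "a - 1"] anti[of "a - 1" a] \<open>j < a\<close> j(2) a(2) by simp
    then have "a - 1 \<notin># p" using N_Suc[of "a - 1"] \<open>j < a\<close> a(2) by (simp add: not_in_iff)
    moreover have "a - 1 \<noteq> 0" using \<open>j < a\<close> j(1) by (auto simp: J_iff)
    ultimately show "v \<in> ?N ` A" using a(2) by (auto simp: A_def)
  next
    fix v assume "v \<in> ?N ` A"
    then obtain a where a: "a \<in># p" "a - 1 \<notin># p" "a - 1 \<noteq> 0" "v = ?N a"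
      by (auto simp: A_def)
    have "?N (a - 1) = v" using N_Suc[of "a - 1"] a by (simp add: not_in_iff)
    moreover have "0 < v" using N_Suc[of a] a by simp
    ultimately have "{a - 1, a} \<subseteq> {j \<in> J. ?N j = v}" using a by (auto simp: J_iff)
    then have "card {a - 1, a} \<le> card {j \<in> J. ?N j = v}"
      by (rule card_mono[rotated]) (simp add: finJ)
    then have "1 < count (conjugate_partition p) v" using a(3) by (simp add: count)
    moreover from this have "v \<in># conjugate_partition p"
      by (metis count_greater_zero_iff less_trans zero_less_one)
    ultimately show "v \<in> {v \<in> set_mset (conjugate_partition p). count (conjugate_partition p) v > 1}"
      by simp
  qed
  \<comment> \<open>\<open>?N\<close> drops strictly right after each part, so it separates any two
    parts.\<close>
  moreover have "inj_on ?N A"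
  proof (rule linorder_inj_onI)
    fix j k assume "j < k" "j \<in> A" "k \<in> A"
    then show "?N j \<noteq> ?N k"
      using anti[of "Suc j" k] N_Suc[of j] by (simp add: A_def flip: count_greater_zero_iff)
  qed auto
  ultimately show ?thesis
    using card_image[of ?N A] by (simp add: num_repeated_eq num_large_gaps_eq[OF assms] A_def)
qed

section \<open>Decorations of weight 5 and the maximal degree\<close>

text \<open>The last four pairs are the first four with \<open>W\<close> and \<open>E\<close>
  exchanged.\<close>

definition max_decorations :: "(nat multiset \<times> nat multiset) set" where
  "max_decorations =
    {({#1, 2#}, {#2#}), ({#1, 2#}, {#1, 1#}), ({#1, 3#}, {#1#}), ({#1, 1, 2#}, {#1#}),
     ({#2#}, {#1, 2#}), ({#1, 1#}, {#1, 2#}), ({#1#}, {#1, 3#}), ({#1#}, {#1, 1, 2#})}"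

text \<open>Three distinct positive integers sum to at least 6, and so do two distinct ones in each
  of \<open>W\<close> and \<open>E\<close>; so 2 + 1 and 1 + 2 are the best splits. The proof checks
  every split of 5 into two weights.\<close>

lemma weight_5:
  fixes W E :: "nat multiset"
  assumes "0 \<notin># W" "0 \<notin># E" "sum_mset W + sum_mset E = 5"
  shows "card (set_mset W) + card (set_mset E) \<le> 3"
    and "card (set_mset W) + card (set_mset E) = 3 \<Longrightarrow> (W, E) \<in> max_decorations"
proof -
  define w where "w = sum_mset W"
  have WE: "W \<in> partitions w" "E \<in> partitions (5 - w)" "w \<le> 5"
    using assms by (auto simp: partitions_def w_def)
  note small = partitions_0 partitions_1 partitions_2 partitions_3 partitions_4 partitions_5
  consider "W \<in> partitions 0" "E \<in> partitions 5" | "W \<in> partitions 1" "E \<in> partitions 4"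
    | "W \<in> partitions 2" "E \<in> partitions 3" | "W \<in> partitions 3" "E \<in> partitions 2"
    | "W \<in> partitions 4" "E \<in> partitions 1" | "W \<in> partitions 5" "E \<in> partitions 0"
  proof -
    have "w = 0 \<or> w = 1 \<or> w = 2 \<or> w = 3 \<or> w = 4 \<or> w = 5" using WE(3) by linarith
    then show thesis using WE(1,2) that by (elim disjE) simp_all
  qed
  then have "card (set_mset W) + card (set_mset E) \<le> 3 \<and>
    (card (set_mset W) + card (set_mset E) = 3 \<longrightarrow> (W, E) \<in> max_decorations)"
    by cases (unfold small, (elim insertE emptyE; simp add: max_decorations_def)+)
  then show "card (set_mset W) + card (set_mset E) \<le> 3"
    and "card (set_mset W) + card (set_mset E) = 3 \<Longrightarrow> (W, E) \<in> max_decorations"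
    by blast+
qed

lemma triangular_Suc: "triangular (Suc s) = triangular s + Suc s"
  by (simp add: triangular_def)

text \<open>A partition with r distinct sizes is a decorated staircase, so its sum is at least
  \<open>triangular r\<close>.\<close>

lemma card_le_of_partition:
  assumes "p \<in> partitions n" "n < triangular (Suc s)"
  shows "card (set_mset p) \<le> s"
proof (rule ccontr)
  assume "\<not> card (set_mset p) \<le> s"
  then have "Suc s \<le> card (set_mset p)" by simp
  then have "triangular (Suc s) \<le> triangular (card (set_mset p))"
    by (rule lift_Suc_mono_le[of triangular, rotated]) (simp add: triangular_Suc)
  moreover have "triangular (card (set_mset p)) \<le> n"
  proof -
    obtain W E where WE: "(W, E) \<in> decorations (card (set_mset p))"
      "p = decorated_staircase (card (set_mset p)) W E"
      using obtain_decoration[of p] assms(1) by (auto simp: partitions_def)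
    then show ?thesis
      using decorated_staircase_in_partitions[OF WE(1)] assms(1) by (simp add: partitions_def)
  qed
  ultimately show False using assms(2) by simp
qed

lemma num_repeated_le: "num_repeated p \<le> card (set_mset p)"
  unfolding num_repeated_eq by (intro card_mono) auto

lemma num_large_gaps_le: "num_large_gaps p \<le> card (set_mset p)"
  unfolding num_large_gaps_def 
  by (rule order_trans[OF card_mono[of "{..<card (set_mset p)}"]]) auto

lemma mem_max_decorations:
  assumes "(W, E) \<in> max_decorations"
  shows "0 \<notin># W" "0 \<notin># E" "sum_mset W + sum_mset E = 5"
    "card (set_mset W) + card (set_mset E) = 3"
  using assms by (auto simp: max_decorations_def)

lemma max_decorations_subset:
  assumes "s \<ge> 5"
  shows "max_decorations \<subseteq> decorations s"
proof
  fix d assume "d \<in> max_decorations"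
  moreover obtain W E where "d = (W, E)" by fastforce
  ultimately show "d \<in> decorations s"
    using mem_max_decorations[of W E] small_decorations[of W E s] assms by simp
qed

lemma partition_deg_decorated:
  assumes "s \<ge> 5" "(W, E) \<in> max_decorations"
  shows "decorated_staircase s W E \<in> partitions (triangular s + 5)"
    and "partition_deg (triangular s + 5) (decorated_staircase s W E) = s * (s - 1) + 3"
proof -
  have dec: "(W, E) \<in> decorations s"
    using assms max_decorations_subset by blast
  show part: "decorated_staircase s W E \<in> partitions (triangular s + 5)"
    using decorated_staircase_in_partitions[OF dec] mem_max_decorations(3)[OF assms(2)]
    by (simp add: add.assoc)
  show "partition_deg (triangular s + 5) (decorated_staircase s W E) = s * (s - 1) + 3"
    using partition_deg_eq[OF part] mem_max_decorations(4)[OF assms(2)] assms(1)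
    by (simp add: card_decorated_staircase[OF dec] num_large_gaps_decorated_staircase[OF dec]
        num_repeated_decorated_staircase[OF dec] diff_mult_distrib2)
qed

lemma partition_deg_bound:
  assumes "s \<ge> 5" "p \<in> partitions (triangular s + 5)"
  shows "partition_deg (triangular s + 5) p \<le> s * (s - 1) + 3"
    and "partition_deg (triangular s + 5) p = s * (s - 1) + 3 \<Longrightarrow>
      p \<in> (\<lambda>(W, E). decorated_staircase s W E) ` max_decorations"
proof -
  let ?n = "triangular s + 5" and ?r = "card (set_mset p)"
  note deg = partition_deg_eq[OF assms(2)]
  \<comment> \<open>The next triangular number exceeds \<open>triangular s\<close> by
    \<open>s + 1\<close>, which is more than 5.\<close>
  have "?r \<le> s"
    using assms by (intro card_le_of_partition) (auto simp: triangular_Suc)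
  have "partition_deg ?n p \<le> s * (s - 1) + 3 \<and> (partition_deg ?n p = s * (s - 1) + 3 \<longrightarrow>
      p \<in> (\<lambda>(W, E). decorated_staircase s W E) ` max_decorations)"
  proof (cases "?r = s")
    case True
    have 0: "0 \<notin># p" using assms(2) by (simp add: partitions_def)
    obtain W E where WE: "(W, E) \<in> decorations s" "p = decorated_staircase s W E"
      using obtain_decoration[OF 0] True by auto
    \<comment> \<open>Comparing the sum of \<open>p\<close> with that of the staircase leaves weight
      exactly 5 for the decoration.\<close>
    have pos: "0 \<notin># W" "0 \<notin># E" "sum_mset W + sum_mset E = 5"
      using indices_bounded[OF WE(1)] 0 decorated_staircase_in_partitions[OF WE(1)] assms(2) WE(2)
      by (auto simp: decorated_staircase_def partitions_def)
    have "partition_deg ?n p = s * (s - 1) + (card (set_mset W) + card (set_mset E))"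
      using deg assms(1)
      by (simp add: True diff_mult_distrib2 WE(2) num_large_gaps_decorated_staircase[OF WE(1)]
          num_repeated_decorated_staircase[OF WE(1)] card_decorated_staircase[OF WE(1)])
    then show ?thesis using weight_5[OF pos] WE(2) by auto
  next
    case False
    then have "Suc ?r \<le> s" using \<open>?r \<le> s\<close> by simp
    \<comment> \<open>With A and B at most r, the degree is at most r * r - r + 2 * r = (r + 1) * r.
      For r < s this stays below the claimed maximum, so the equality case cannot occur.\<close>
    then have "Suc ?r * ?r \<le> s * (s - 1)"
      by (intro mult_le_mono) auto
    moreover have "partition_deg ?n p \<le> Suc ?r * ?r"
      using deg num_large_gaps_le[of p] num_repeated_le[of p] by simp
    ultimately show ?thesis by simp
  qed
  then show "partition_deg ?n p \<le> s * (s - 1) + 3"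
    and "partition_deg ?n p = s * (s - 1) + 3 \<Longrightarrow>
      p \<in> (\<lambda>(W, E). decorated_staircase s W E) ` max_decorations"
    by blast+
qed

lemma max_deg_partitions_eq:
  assumes "s \<ge> 5"
  shows "max_deg_partitions (triangular s + 5)
    = (\<lambda>(W, E). decorated_staircase s W E) ` max_decorations"
proof -
  have ex: "({#2#}, {#1, 2#}) \<in> max_decorations" by (simp add: max_decorations_def)
  have "max_deg (triangular s + 5) = s * (s - 1) + 3"
    unfolding max_deg_def
  proof (rule Max_eqI)
    show "s * (s - 1) + 3 \<in> partition_deg (triangular s + 5) ` partitions (triangular s + 5)"
      using partition_deg_decorated[OF assms ex] by (metis imageI)
  qed (use finite_partitions partition_deg_bound[OF assms] in auto)
  then show ?thesis
    using partition_deg_decorated[OF assms] partition_deg_bound[OF assms]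
    by (auto simp: max_deg_partitions_def)
qed

section \<open>Types, cardinalities and self-conjugate partitions\<close>

theorem proposition7p3:
  fixes s :: nat
  assumes "s \<ge> 5"
  shows "max_deg_types (triangular s + 5) = {(2, 1), (1, 2)}
    \<and> card (max_deg_partitions_of_type (triangular s + 5) (2, 1)) = 4
    \<and> card (max_deg_partitions_of_type (triangular s + 5) (1, 2)) = 4
    \<and> card (max_deg_partitions (triangular s + 5)) = 8
    \<and> num_self_conj_max (triangular s + 5) = 0"
proof -
  let ?n = "triangular s + 5"
  define f where "f = (\<lambda>(W, E). decorated_staircase s W E)"
  define dtype where "dtype d = (card (set_mset (fst d)), card (set_mset (snd d)))"
    for d :: "nat multiset \<times> nat multiset"
  define ptype where "ptype p = (num_large_gaps p, num_repeated p)" for p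
  have M: "max_deg_partitions ?n = f ` max_decorations"
    unfolding f_def by (rule max_deg_partitions_eq[OF assms])
  have type: "ptype (f d) = dtype d" if "d \<in> max_decorations" for d
  proof (cases d)
    case (Pair W E)
    then have "(W, E) \<in> decorations s"
      using that max_decorations_subset[OF assms] by blast
    then show ?thesis
      by (simp add: Pair f_def dtype_def ptype_def
          num_large_gaps_decorated_staircase num_repeated_decorated_staircase)
  qed
  have inj: "inj_on f max_decorations"
    unfolding f_def
    using inj_on_decorated_staircase max_decorations_subset[OF assms] by (rule inj_on_subset)
  have "max_deg_types ?n = ptype ` max_deg_partitions ?n"
    by (simp add: max_deg_types_def ptype_def)
  also have "\<dots> = dtype ` max_decorations"
    unfolding M image_image using type by simp
  also have "\<dots> = {(2, 1), (1, 2)}"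
    by (simp add: max_decorations_def dtype_def numeral_2_eq_2)
  finally have types: "max_deg_types ?n = {(2, 1), (1, 2)}" .
  \<comment> \<open>As \<open>f\<close> is injective and preserves types, counting partitions of a
    type reduces to counting entries of the explicit list.\<close>
  have of_type: "card (max_deg_partitions_of_type ?n ab)
      = card {d \<in> max_decorations. dtype d = ab}" for ab
  proof -
    have "max_deg_partitions_of_type ?n ab = {p \<in> max_deg_partitions ?n. ptype p = ab}"
      by (simp add: max_deg_partitions_of_type_def ptype_def)
    also have "\<dots> = f ` {d \<in> max_decorations. dtype d = ab}"
      using type by (auto simp: M)
    finally show ?thesis
      using inj by (simp add: card_image inj_on_def)
  qed
  have "{d \<in> max_decorations. dtype d = (2, 1)} =
      {({#1, 2#}, {#2#}), ({#1, 2#}, {#1, 1#}), ({#1, 3#}, {#1#}), ({#1, 1, 2#}, {#1#})}"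
    by (auto simp: max_decorations_def dtype_def)
  then have "card (max_deg_partitions_of_type ?n (2, 1)) = 4"
    by (simp add: of_type)
  moreover have "{d \<in> max_decorations. dtype d = (1, 2)} =
      {({#2#}, {#1, 2#}), ({#1, 1#}, {#1, 2#}), ({#1#}, {#1, 3#}), ({#1#}, {#1, 1, 2#})}"
    by (auto simp: max_decorations_def dtype_def)
  then have "card (max_deg_partitions_of_type ?n (1, 2)) = 4"
    by (simp add: of_type)
  moreover have "card (max_deg_partitions ?n) = 8"
    unfolding M card_image[OF inj] by (simp add: max_decorations_def)
  moreover have "num_self_conj_max ?n = 0"
  proof -
    have "p \<noteq> conjugate_partition p" if p: "p \<in> max_deg_partitions ?n" for p
    proof
      assume "p = conjugate_partition p"
      moreover have "0 \<notin># p"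
        using p by (simp add: max_deg_partitions_def partitions_def)
      ultimately have "num_repeated p = num_large_gaps p"
        using num_repeated_conjugate by metis
      moreover have "(num_large_gaps p, num_repeated p) \<in> {(2, 1), (1, 2)}"
        using p types by (auto simp: max_deg_types_def)
      ultimately show False by auto
    qed
    then have "{p \<in> max_deg_partitions ?n. p = conjugate_partition p} = {}" by blast
    then show ?thesis by (simp only: num_self_conj_max_def card.empty)
  qed
  ultimately show ?thesis
    using types by blast
qed

end
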